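(* Let $0<q<1$, let $a,b,c,d\in\mathbb{R}$ with $\max(|a|,|b|,|c|,|d|)<1$, let $n,m\in\mathbb{N}$, and let $x=\frac12(z+z^{-1})$, $z\neq0$. Then $$\begin{aligned}p_{n+m}(x;a,b,c,d|q)=\sum_{k=0}^{\min(n,m)}&\frac{(q^{-n},q^{-m},abcdq^{2n+m-1};q)_k}{(q;q)_k}\,z^{-2k}\,(az,bz,cz,dz;q)_k\;q^{-k^2+k+\frac12nm+\frac12km+nk}\\&\times p_{n-k}\bigl(\tfrac12(q^{k/2}z+q^{-k/2}z^{-1});aq^{k/2},bq^{k/2},cq^{k/2},dq^{k/2}|q\bigr)\\&\times p_{m-k}\bigl(\tfrac12(q^{(k-n)/2}z+q^{(n-k)/2}z^{-1});aq^{(k+n)/2},bq^{(k+n)/2},cq^{(k+n)/2},dq^{(k+n)/2}|q\bigr).\end{aligned}$$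
   Context: $\mathbb N=\{0,1,2,\dots\}$. $(y;q)_k=\prod_{j=0}^{k-1}(1-yq^j)$ and $(y_1,\dots,y_r;q)_k=\prod_i(y_i;q)_k$. The Askey–Wilson polynomials are, with $x=\frac12(z+z^{-1})$, $$p_n(x;a,b,c,d|q)=a^{-n}(ab,ac,ad;q)_n\sum_{j=0}^n\frac{(q^{-n},abcdq^{n-1},az,a/z;q)_j}{(ab,ac,ad,q;q)_j}q^j,$$ which are polynomials of degree $n$ in $x$, symmetric in $a,b,c,d$ (with the case where $a=0$ understood by continuity). *)

theory Defs
  imports "HOL-Analysis.Analysis"
begin

definition qpoch :: "complex \<Rightarrow> complex \<Rightarrow> nat \<Rightarrow> complex" where
  "qpoch y q k = (\<Prod>j<k. 1 - y * q ^ j)"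

definition qpochs :: "complex list \<Rightarrow> complex \<Rightarrow> nat \<Rightarrow> complex" where
  "qpochs ys q k = (\<Prod>y\<leftarrow>ys. qpoch y q k)"

text \<open>
  The defining series, as a function of \<open>z\<close>. It is meaningful when \<open>a\<close>, \<open>z\<close> and the factors of the
  denominators are nonzero (as they are if \<open>0 < |q| < 1\<close>, \<open>0 < |a| < 1\<close> and \<open>|b|, |c|, |d| < 1\<close>).
\<close>

definition aw_series ::
  "nat \<Rightarrow> complex \<Rightarrow> complex \<Rightarrow> complex \<Rightarrow> complex \<Rightarrow> complex \<Rightarrow> complex \<Rightarrow> complex" where
  "aw_series n z a b c d q =
     a powi (- int n) * qpochs [a * b, a * c, a * d] q n *
     (\<Sum>j=0..n. qpochs [q powi (- int n), a * b * c * d * q powi (int n - 1), a * z, a / z] q j /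
                 qpochs [a * b, a * c, a * d, q] q j * q ^ j)"

text \<open>
  The Askey-Wilson polynomial \<open>p\<^sub>n(x; a, b, c, d | q)\<close>. The representation \<open>x = (z + 1/z)/2\<close>
  determines \<open>z\<close> up to \<open>z \<mapsto> 1/z\<close>, under which the series is invariant, so the choice of \<open>z\<close>
  is immaterial. At \<open>a = 0\<close> the value is the limit in the parameter \<open>a\<close>.
\<close>

definition askey_wilson ::
  "nat \<Rightarrow> complex \<Rightarrow> complex \<Rightarrow> complex \<Rightarrow> complex \<Rightarrow> complex \<Rightarrow> complex \<Rightarrow> complex" where
  "askey_wilson n x a b c d q =
     (let z = (SOME z. z \<noteq> 0 \<and> x = (z + inverse z) / 2)
      in if a = 0 then Lim (at 0) (\<lambda>a'. aw_series n z a' b c d q)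
         else aw_series n z a b c d q)"

lemma aw_series_inverse: "aw_series n (inverse z) a b c d q = aw_series n z a b c d q"
  by (simp add: aw_series_def qpochs_def field_simps)

lemma joukowski_eq_iff:
  fixes w z :: complex
  assumes "w \<noteq> 0" "z \<noteq> 0"
  shows "(w + inverse w) / 2 = (z + inverse z) / 2 \<longleftrightarrow> w = z \<or> w = inverse z"
proof -
  have "(w + inverse w) / 2 = (z + inverse z) / 2 \<longleftrightarrow> (w - z) * (w * z - 1) = 0"
    using assms by (simp add: field_simps) algebra
  also have "\<dots> \<longleftrightarrow> w = z \<or> w = inverse z"
    using assms by (simp only: mult_eq_0_iff) (auto simp: inverse_eq_divide eq_divide_eq)
  finally show ?thesis .
qed

lemma askey_wilson_joukowski:
  assumes "z \<noteq> 0"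
  shows "askey_wilson n ((z + inverse z) / 2) a b c d q =
           (if a = 0 then Lim (at 0) (\<lambda>a'. aw_series n z a' b c d q) else aw_series n z a b c d q)"
proof -
  define w where "w = (SOME w. w \<noteq> 0 \<and> (z + inverse z) / 2 = (w + inverse w) / 2)"
  have "w \<noteq> 0 \<and> (z + inverse z) / 2 = (w + inverse w) / 2"
    unfolding w_def by (rule someI[of _ z]) (use assms in simp)
  then have "w = z \<or> w = inverse z"
    using joukowski_eq_iff[of w z] assms by metis
  then have "aw_series n w a' b c d q = aw_series n z a' b c d q" for a'
    by (auto simp: aw_series_inverse)
  then show ?thesis
    unfolding askey_wilson_def w_def[symmetric] by (simp add: Let_def)
qed

end

theory Submission
  imports Defs
begin

text \<open>
  Write \<open>s = sqrt q\<close>, \<open>t = abcd\<close>, and let \<open>p\<^sub>n (z; A)\<close> be the Askey-Wilson polynomial at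
  \<open>x = (z + 1 / z) / 2\<close> with parameters \<open>A = (a, b, c, d)\<close>. The formula is a \<open>q\<close>-analogue of the
  Leibniz rule. It rests on two shift relations: the lowering relation
  \<open>p\<^sub>n (s z; A) - p\<^sub>n (z / s; A) = c (z - 1 / z) p\<^sub>n\<^sub>-\<^sub>1 (z; A s)\<close> with
  \<open>c = (q\<^sup>n - 1) (1 - t q\<^sup>n\<^sup>-\<^sup>1) / s\<^sup>n\<close> (\<open>aw_lowering\<close>), and the raising relation
  \<open>(z - 1 / z) p\<^sub>n\<^sub>+\<^sub>1 (z; A) = s\<^sup>n (V (1 / z) p\<^sub>n (z / s; A s) - V z p\<^sub>n (s z; A s))\<close> with
  \<open>V z = (1 - a z) (1 - b z) (1 - c z) (1 - d z) / z\<^sup>2\<close> (\<open>aw_raising\<close>).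

  Applying the raising operator \<open>n\<close> times to \<open>p\<^sub>m (z; A s\<^sup>n)\<close> gives \<open>p\<^sub>n\<^sub>+\<^sub>m\<close>. On the other hand,
  \<open>n\<close> raising operators applied to an arbitrary function \<open>g\<close> can be expanded in the divided
  differences of \<open>g\<close> of order \<open>k \<le> n\<close>. The coefficient of the \<open>k\<close>-th one is a Gaussian binomial
  coefficient times \<open>p\<^sub>n\<^sub>-\<^sub>k (s\<^sup>k z; A s\<^sup>k)\<close> times a product of values of \<open>V\<close>, because \<open>V\<close> intertwines
  raising operators at shifted arguments (\<open>aw_factor_up\<close>, \<open>aw_factor_down\<close>). For
  \<open>g = p\<^sub>m (z; A s\<^sup>n)\<close> the \<open>k\<close>-th divided difference is a multiple of \<open>p\<^sub>m\<^sub>-\<^sub>k (z; A s\<^sup>n\<^sup>+\<^sup>k)\<close>, and this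
  is the stated sum. The induction (\<open>aw_poly_add\<close>) works with this choice of \<open>g\<close> throughout: one
  summand is treated in \<open>aw_poly_add_step\<close>, and the summands are collected by the two \<open>q\<close>-Pascal
  rules.

  Raising and lowering together give \<open>p\<^sub>n\<^sub>+\<^sub>1\<close> as a combination of \<open>p\<^sub>n\<close> and \<open>p\<^sub>n\<^sub>-\<^sub>1\<close> at shifted
  arguments, with coefficients that have no denominators except powers of \<open>z\<close>. This recursion is
  taken as a definition (\<open>aw_poly\<close>), and both relations are derived from it. The hypergeometric
  series satisfies the raising relation too, as one sees on the basis \<open>(az, a/z; q)\<^sub>j\<close>
  (\<open>aw_sum_raising\<close>), so the two agree for \<open>a \<noteq> 0\<close>; continuity of the recursion supplies the case
  \<open>a = 0\<close> (\<open>askey_wilson_eq_aw_poly\<close>).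
\<close>

section \<open>Raising and lowering relations\<close>

text \<open>
  The coefficient in the raising operator
  \<open>f \<mapsto> (aw_weight (1 / z) * f (z / s) - aw_weight z * f (s * z)) / (z - 1 / z)\<close>.
\<close>

definition aw_weight :: "complex \<Rightarrow> complex \<Rightarrow> complex \<Rightarrow> complex \<Rightarrow> complex \<Rightarrow> complex" where
  "aw_weight z a b c d = (1 - a * z) * (1 - b * z) * (1 - c * z) * (1 - d * z) / z\<^sup>2"

definition aw_linear :: "complex \<Rightarrow> complex \<Rightarrow> complex \<Rightarrow> complex \<Rightarrow> complex \<Rightarrow> complex" where
  "aw_linear z a b c d = (1 - a * b * c * d) * (z + 1 / z)
     - (a + b + c + d) + (a * b * c + a * b * d + a * c * d + b * c * d)"

text \<open>
  The Askey-Wilson polynomial with base \<open>q = s\<^sup>2\<close>, as a function of \<open>z\<close>. The recursion is the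
  case \<open>n = 1\<close> of the addition formula. No division by a parameter or by \<open>z - 1 / z\<close> occurs in it,
  so the values at \<open>a = 0\<close> and at \<open>z = 1\<close> or \<open>z = -1\<close> need no separate treatment and continuity in
  all arguments is immediate. For \<open>m = 0\<close> the second summand vanishes through \<open>1 - s ^ (2 * m)\<close>, so
  the truncated \<open>m - 1\<close> is harmless.
\<close>

fun aw_poly ::
  "complex \<Rightarrow> nat \<Rightarrow> complex \<Rightarrow> complex \<Rightarrow> complex \<Rightarrow> complex \<Rightarrow> complex \<Rightarrow> complex" where
  "aw_poly s 0 z a b c d = 1"
| "aw_poly s (Suc m) z a b c d =
     s ^ m * aw_linear z a b c d * aw_poly s m (z / s) (a * s) (b * s) (c * s) (d * s)
     + (1 - s ^ (2 * m)) * (1 - a * b * c * d * s ^ (2 * m + 2)) * aw_weight z a b c d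
       * aw_poly s (m - 1) z (a * s\<^sup>2) (b * s\<^sup>2) (c * s\<^sup>2) (d * s\<^sup>2)"

text \<open>
  The raising operator applied to the constant \<open>1\<close>: this quotient of an antisymmetric
  function by \<open>z - 1 / z\<close> is the first Askey-Wilson polynomial, and it is what allows the
  denominator of the raising operator to be divided out once and for all.
\<close>

lemma aw_weight_diff:
  assumes "z \<noteq> 0"
  shows "aw_weight (1 / z) a b c d - aw_weight z a b c d = (z - 1 / z) * aw_linear z a b c d"
  using assms by (simp add: aw_weight_def aw_linear_def field_simps) algebra

lemma aw_weight_shift:
  assumes "s \<noteq> 0"
  shows "s\<^sup>2 * aw_weight (s * y) a b c d = aw_weight y (a * s) (b * s) (c * s) (d * s)"
  using assms by (cases "y = 0") (simp_all add: aw_weight_def power_mult_distrib mult_ac)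

text \<open>
  Substituting the lowering relation for the difference of the two shifted values turns the
  raising relation into the defining recursion. It is separated from the relation itself because
  the induction for the lowering relation needs it one degree below.
\<close>

lemma aw_raising_if_lowering:
  assumes "s \<noteq> 0" "z \<noteq> 0"
    and lowering: "aw_poly s m (s * z) (a * s) (b * s) (c * s) (d * s)
         - aw_poly s m (z / s) (a * s) (b * s) (c * s) (d * s) =
         (s ^ (2 * m) - 1) * (1 - a * b * c * d * s ^ (2 * m + 2)) / s ^ m * (z - 1 / z)
         * aw_poly s (m - 1) z (a * s\<^sup>2) (b * s\<^sup>2) (c * s\<^sup>2) (d * s\<^sup>2)"
  shows "(z - 1 / z) * aw_poly s (Suc m) z a b c d =
     s ^ m * (aw_weight (1 / z) a b c d * aw_poly s m (z / s) (a * s) (b * s) (c * s) (d * s)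
            - aw_weight z a b c d * aw_poly s m (s * z) (a * s) (b * s) (c * s) (d * s))"
proof -
  let ?G = "aw_poly s (m - 1) z (a * s\<^sup>2) (b * s\<^sup>2) (c * s\<^sup>2) (d * s\<^sup>2)"
  let ?F = "\<lambda>z. aw_poly s m z (a * s) (b * s) (c * s) (d * s)"
  let ?V = "aw_weight z a b c d"
  have "s ^ m * (?F (s * z) - ?F (z / s)) =
      (s ^ (2 * m) - 1) * (1 - a * b * c * d * s ^ (2 * m + 2)) * (z - 1 / z) * ?G"
    using assms(1) unfolding lowering by simp
  moreover have "aw_weight (1 / z) a b c d = ?V + (z - 1 / z) * aw_linear z a b c d"
    using aw_weight_diff[OF assms(2), of a b c d] by (simp add: algebra_simps)
  moreover have "x * (S * l * f + (1 - Q) * u * v * g) = S * (w * f - v * p)"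
    if "S * (p - f) = (Q - 1) * u * x * g" "w = v + x * l" for x S l f Q u v g w p :: complex
  proof -
    have "S * (w * f - v * p) = S * x * l * f - v * (S * (p - f))"
      by (simp add: that(2) algebra_simps)
    then show ?thesis unfolding that(1) by (simp add: algebra_simps)
  qed
  ultimately show ?thesis
    unfolding aw_poly.simps by blast
qed

text \<open>
  The divided difference of degree \<open>m + 1\<close> is expanded by the recursion. At \<open>s * y\<close> the
  recursion refers to the polynomial of degree \<open>m\<close> at \<open>y\<close>; at \<open>y / s\<close> it refers to the value at
  \<open>y / s\<^sup>2\<close>, which the induction hypothesis moves to \<open>y\<close>. The remaining terms of degree \<open>m - 1\<close>
  recombine by the raising relation at shifted parameters into the value at \<open>y\<close> again. This is
  the shape invariance of the Askey-Wilson operator: up to the factor \<open>q\<close> and an additive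
  constant, lowering after raising equals raising after lowering.
\<close>

lemma aw_lowering:
  assumes "s \<noteq> 0" "y \<noteq> 0"
  shows "aw_poly s m (s * y) a b c d - aw_poly s m (y / s) a b c d =
     (s ^ (2 * m) - 1) * (1 - a * b * c * d * s ^ (2 * (m - 1))) / s ^ m * (y - 1 / y)
     * aw_poly s (m - 1) y (a * s) (b * s) (c * s) (d * s)"
  using assms(2)
proof (induction m arbitrary: y a b c d rule: less_induct)
  case (less n)
  show ?case
  proof (cases n)
    case 0
    then show ?thesis by simp
  next
    case (Suc m)
    note y = \<open>y \<noteq> 0\<close>
    define t where "t = a * b * c * d"
    define F where "F w = aw_poly s m w (a * s) (b * s) (c * s) (d * s)" for w
    define H where "H w = aw_poly s (m - 1) w (a * s\<^sup>2) (b * s\<^sup>2) (c * s\<^sup>2) (d * s\<^sup>2)" for w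
    define \<kappa> where "\<kappa> = (s ^ (2 * m) - 1) * (1 - t * s ^ (2 * m + 2)) / s ^ m"
    have lower: "F (s * w) - F (w / s) = \<kappa> * (w - 1 / w) * H w" if "w \<noteq> 0" for w
    proof (cases m)
      case 0
      then show ?thesis by (simp add: F_def \<kappa>_def)
    next
      case (Suc l)
      have "a * s * (b * s) * (c * s) * (d * s) * s ^ (2 * (m - 1)) = t * s ^ (2 * m + 2)"
        by (simp add: Suc t_def power2_eq_square mult_ac)
      then show ?thesis
        using less.IH[of m w, of "a * s" "b * s" "c * s" "d * s"]
        by (simp add: \<open>n = Suc m\<close> F_def H_def \<kappa>_def power2_eq_square mult.assoc that)
    qed
    have rec: "aw_poly s (Suc m) w a b c d =
        s ^ m * (aw_linear w a b c d * F (w / s) - \<kappa> * aw_weight w a b c d * H w)" for w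
      using assms(1) by (simp add: F_def H_def \<kappa>_def t_def field_simps)
    have up: "aw_poly s (Suc m) (s * y) a b c d =
        s ^ m * (aw_linear (s * y) a b c d * F y - \<kappa> * aw_weight (s * y) a b c d * H (s * y))"
      using rec[of "s * y"] assms(1) by simp
    have down: "aw_poly s (Suc m) (y / s) a b c d =
        s ^ m * (aw_linear (y / s) a b c d * F y - \<kappa> * aw_weight (1 / (y / s)) a b c d * H (y / s))"
    proof -
      have "F y - F (y / s / s) = \<kappa> * (y / s - 1 / (y / s)) * H (y / s)"
        using lower[of "y / s"] assms(1) y by simp
      moreover have "aw_weight (1 / (y / s)) a b c d - aw_weight (y / s) a b c d =
          (y / s - 1 / (y / s)) * aw_linear (y / s) a b c d"
        by (rule aw_weight_diff) (use assms(1) y in simp)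
      moreover have "l * f' - k * v * h = l * f - k * w * h"
        if "f - f' = k * x * h" "w - v = x * l" for l f f' k v h w x :: complex
        using that by algebra
      ultimately show ?thesis
        unfolding rec by metis
    qed
    have cross: "s\<^sup>2 * (\<kappa> * (aw_weight (1 / (y / s)) a b c d * H (y / s) - aw_weight (s * y) a b c d * H (s * y)))
        = \<kappa> * (s * ((y - 1 / y) * F y)) / s ^ m"
    proof (cases m)
      case 0
      then show ?thesis by (simp add: \<kappa>_def)
    next
      case (Suc l)
      have raise: "(y - 1 / y) * F y = s ^ l *
          (aw_weight (1 / y) (a * s) (b * s) (c * s) (d * s) * H (y / s)
           - aw_weight y (a * s) (b * s) (c * s) (d * s) * H (s * y))"
      proof -
        have "aw_poly s l (s * y) (a * s * s) (b * s * s) (c * s * s) (d * s * s)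
           - aw_poly s l (y / s) (a * s * s) (b * s * s) (c * s * s) (d * s * s) =
           (s ^ (2 * l) - 1) * (1 - a * s * (b * s) * (c * s) * (d * s) * s ^ (2 * l + 2)) / s ^ l * (y - 1 / y)
           * aw_poly s (l - 1) y (a * s * s\<^sup>2) (b * s * s\<^sup>2) (c * s * s\<^sup>2) (d * s * s\<^sup>2)"
          using less.IH[of l y "a * s * s" "b * s * s" "c * s * s" "d * s * s"] y \<open>n = Suc m\<close> Suc
          by (cases l) (simp_all add: power2_eq_square mult_ac)
        from aw_raising_if_lowering[OF assms(1) y this] show ?thesis
          by (simp add: F_def H_def Suc power2_eq_square mult.assoc del: aw_poly.simps)
      qed
      have "s\<^sup>2 * aw_weight (1 / (y / s)) a b c d = aw_weight (1 / y) (a * s) (b * s) (c * s) (d * s)"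
        using aw_weight_shift[OF assms(1), of "1 / y" a b c d] by simp
      moreover note aw_weight_shift[OF assms(1), of y a b c d]
      moreover have "s\<^sup>2 * (k * (v * h - w * h')) = k * (s * (s ^ l * (v' * h - w' * h'))) / s ^ m"
        if "s\<^sup>2 * v = v'" "s\<^sup>2 * w = w'" for k v h w h' v' w' :: complex
        unfolding that[symmetric] using assms(1) by (simp add: Suc field_simps)
      ultimately show ?thesis
        unfolding raise by blast
    qed
    have linear: "aw_linear (s * y) a b c d - aw_linear (y / s) a b c d = (1 - t) * (s - 1 / s) * (y - 1 / y)"
      using assms(1) y by (simp add: aw_linear_def t_def field_simps)
    have combine: "S * (l * f - \<kappa> * w * h) - S * (l' * f - \<kappa> * w' * h') =
        (S\<^sup>2 * s\<^sup>2 - 1) * (1 - t * S\<^sup>2) / (s * S) * x * f"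
      if "s\<^sup>2 * (\<kappa> * (w' * h' - w * h)) = \<kappa> * (s * (x * f)) / S"
        "l - l' = (1 - t) * (s - 1 / s) * x" "\<kappa> = (S\<^sup>2 - 1) * (1 - t * S\<^sup>2 * s\<^sup>2) / S" "S \<noteq> 0"
      for S l l' f w w' h h' x
    proof -
      have e: "\<kappa> * (w' * h' - w * h) = \<kappa> * (x * f) / (s * S)"
      proof -
        have "\<kappa> * (w' * h' - w * h) = s\<^sup>2 * (\<kappa> * (w' * h' - w * h)) / s\<^sup>2"
          using assms(1) by simp
        also have "\<dots> = \<kappa> * (x * f) / (s * S)"
          unfolding that(1) using assms(1) by (simp add: power2_eq_square)
        finally show ?thesis .
      qed
      have "S * (l * f - \<kappa> * w * h) - S * (l' * f - \<kappa> * w' * h') =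
          S * ((l - l') * f + \<kappa> * (w' * h' - w * h))"
        by (simp add: algebra_simps)
      also have "\<dots> = S * x * f * ((1 - t) * (s - 1 / s) + \<kappa> / (s * S))"
        unfolding e that(2) by (simp add: algebra_simps)
      also have "(1 - t) * (s - 1 / s) + \<kappa> / (s * S) =
          (S\<^sup>2 * s\<^sup>2 - 1) * (1 - t * S\<^sup>2) / (s * S) / S"
        unfolding that(3) using assms(1) \<open>S \<noteq> 0\<close> by (simp add: field_simps power2_eq_square)
      also have "S * x * f * (r / S) = r * x * f" for r
        using \<open>S \<noteq> 0\<close> by simp
      finally show ?thesis .
    qed
    have pow: "s ^ (2 * m) = (s ^ m)\<^sup>2" "s ^ (2 * m + 2) = (s ^ m)\<^sup>2 * s\<^sup>2"
      by (simp_all add: power_add power_mult power2_eq_square power_mult_distrib)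
    have "\<kappa> = ((s ^ m)\<^sup>2 - 1) * (1 - t * (s ^ m)\<^sup>2 * s\<^sup>2) / s ^ m" "s ^ m \<noteq> 0"
      using assms(1) by (simp_all add: \<kappa>_def pow mult.assoc flip: power2_eq_square)
    from combine[OF cross linear this]
    have "aw_poly s (Suc m) (s * y) a b c d - aw_poly s (Suc m) (y / s) a b c d =
        ((s ^ m)\<^sup>2 * s\<^sup>2 - 1) * (1 - t * (s ^ m)\<^sup>2) / (s * s ^ m) * (y - 1 / y) * F y"
      unfolding up down .
    then show ?thesis
      by (simp add: Suc F_def t_def pow mult.assoc power2_eq_square[of s] del: aw_poly.simps)
  qed
qed

lemma aw_raising:
  assumes "s \<noteq> 0" "z \<noteq> 0"
  shows "(z - 1 / z) * aw_poly s (Suc m) z a b c d =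
     s ^ m * (aw_weight (1 / z) a b c d * aw_poly s m (z / s) (a * s) (b * s) (c * s) (d * s)
            - aw_weight z a b c d * aw_poly s m (s * z) (a * s) (b * s) (c * s) (d * s))"
proof (rule aw_raising_if_lowering[OF assms])
  show "aw_poly s m (s * z) (a * s) (b * s) (c * s) (d * s)
         - aw_poly s m (z / s) (a * s) (b * s) (c * s) (d * s) =
         (s ^ (2 * m) - 1) * (1 - a * b * c * d * s ^ (2 * m + 2)) / s ^ m * (z - 1 / z)
         * aw_poly s (m - 1) z (a * s\<^sup>2) (b * s\<^sup>2) (c * s\<^sup>2) (d * s\<^sup>2)"
    using aw_lowering[OF assms, of m "a * s" "b * s" "c * s" "d * s"]
    by (cases m) (simp_all add: power2_eq_square mult_ac del: aw_poly.simps(2))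
qed


section \<open>The hypergeometric series\<close>

lemma qpoch_0 [simp]: "qpoch y q 0 = 1"
  by (simp add: qpoch_def)

lemma qpoch_Suc: "qpoch y q (Suc k) = qpoch y q k * (1 - y * q ^ k)"
  by (simp add: qpoch_def)

lemma qpoch_add: "qpoch y q (j + k) = qpoch y q j * qpoch (y * q ^ j) q k"
  by (induction k) (simp_all add: qpoch_Suc power_add mult_ac)

lemma qpoch_Suc_left: "qpoch y q (Suc k) = (1 - y) * qpoch (y * q) q k"
  using qpoch_add[of y q 1 k] by (simp add: qpoch_Suc)

lemma qpoch_nonzero:
  assumes "norm y < 1" "norm q \<le> 1"
  shows "qpoch y q k \<noteq> 0"
proof (induction k)
  case (Suc k)
  have "norm (y * q ^ k) < 1"
    using assms by (metis norm_mult norm_power mult_left_le power_le_one norm_ge_zero order_le_less_trans)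
  then have "1 - y * q ^ k \<noteq> 0"
    by auto
  then show ?case using Suc by (simp add: qpoch_Suc)
qed simp

text \<open>
  Coefficients of the series with the quotients \<open>(ab; q)\<^sub>n / (ab; q)\<^sub>j\<close> cancelled, so that no
  condition on \<open>b\<close>, \<open>c\<close>, \<open>d\<close> is needed in the manipulations. Writing \<open>q ^ n / q\<close> instead of
  \<open>q ^ (n - 1)\<close> keeps the factor correct at \<open>n = 0\<close>.
\<close>

definition aw_coeff ::
  "complex \<Rightarrow> nat \<Rightarrow> complex \<Rightarrow> complex \<Rightarrow> complex \<Rightarrow> complex \<Rightarrow> nat \<Rightarrow> complex" where
  "aw_coeff q n a b c d j =
     qpoch (a * b * q ^ j) q (n - j) * qpoch (a * c * q ^ j) q (n - j) * qpoch (a * d * q ^ j) q (n - j)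
     * (qpoch (1 / q ^ n) q j * qpoch (a * b * c * d * q ^ n / q) q j / qpoch q q j) * q ^ j / a ^ n"

definition aw_sum ::
  "complex \<Rightarrow> nat \<Rightarrow> complex \<Rightarrow> complex \<Rightarrow> complex \<Rightarrow> complex \<Rightarrow> complex \<Rightarrow> complex" where
  "aw_sum q n z a b c d = (\<Sum>j\<le>n. aw_coeff q n a b c d j * (qpoch (a * z) q j * qpoch (a / z) q j))"

lemma aw_series_eq_aw_sum:
  assumes "q \<noteq> 0" "norm q < 1" "norm (a * b) < 1" "norm (a * c) < 1" "norm (a * d) < 1"
  shows "aw_series n z a b c d q = aw_sum q n z a b c d"
proof -
  have nz: "qpoch (a * b) q j \<noteq> 0" "qpoch (a * c) q j \<noteq> 0" "qpoch (a * d) q j \<noteq> 0" for j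
    by (rule qpoch_nonzero; use assms in simp)+
  have split: "qpoch y q n = qpoch y q j * qpoch (y * q ^ j) q (n - j)" if "j \<le> n" for y j
    using qpoch_add[of y q j "n - j"] that by simp
  have pow: "q powi (int n - 1) = q ^ n / q" "q powi (- int n) = 1 / q ^ n" "a powi (- int n) = 1 / a ^ n"
    using assms(1) by (simp_all add: power_int_diff power_int_minus field_simps)
  show ?thesis
    unfolding aw_series_def aw_sum_def sum_distrib_left atLeast0AtMost pow
  proof (rule sum.cong[OF refl])
    fix j assume "j \<in> {..n}"
    then have "j \<le> n" by simp
    show "1 / a ^ n * qpochs [a * b, a * c, a * d] q n *
        (qpochs [1 / q ^ n, a * b * c * d * (q ^ n / q), a * z, a / z] q j /
          qpochs [a * b, a * c, a * d, q] q j * q ^ j) =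
        aw_coeff q n a b c d j * (qpoch (a * z) q j * qpoch (a / z) q j)"
      unfolding qpochs_def aw_coeff_def
      using nz[of j] by (simp add: split[OF \<open>j \<le> n\<close>]) (simp add: mult_ac)
  qed
qed

lemma one_minus_power_nonzero:
  assumes "norm q < 1"
  shows "1 - q * q ^ k \<noteq> (0::complex)"
proof -
  have "norm (q * q ^ k) < 1"
    using assms power_Suc_less_one[of "norm q" k] by (cases "q = 0") (auto simp: norm_mult norm_power)
  then show ?thesis by auto
qed

lemma aw_coeff_top:
  assumes "q \<noteq> 0"
  shows "aw_coeff q n a b c d (Suc n) = 0"
  using assms by (simp add: aw_coeff_def qpoch_Suc)

lemma aw_coeff_raise_0:
  assumes "s \<noteq> 0" "q = s\<^sup>2"
  shows "aw_coeff q (Suc n) a b c d 0 =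
    s ^ n * (aw_coeff q n (a * s) (b * s) (c * s) (d * s) 0 * ((1 - a * b) * (1 - a * c) * (1 - a * d) / a))"
proof -
  have e: "a * s * (b * s) = a * b * q" "a * s * (c * s) = a * c * q" "a * s * (d * s) = a * d * q"
    by (simp_all add: assms power2_eq_square mult_ac)
  show ?thesis
    unfolding aw_coeff_def e using assms(1)
    by (simp add: qpoch_Suc_left power_mult_distrib mult_ac)
qed

text \<open>
  Comparison of coefficients for the raising relation of the series. The operator maps the
  basis function of index \<open>j\<close> to a combination of those of index \<open>j\<close> and \<open>j + 1\<close>, so two
  coefficients contribute; after common factors are removed, the claim is the contiguous relation
  called \<open>key\<close> below.
\<close>

lemma aw_coeff_raise_Suc:
  assumes "s \<noteq> 0" "q = s\<^sup>2" "norm q < 1" "j \<le> n"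
  shows "aw_coeff q (Suc n) a b c d (Suc j) =
    s ^ n * (aw_coeff q n (a * s) (b * s) (c * s) (d * s) (Suc j)
              * ((1 - a * b * q ^ Suc j) * (1 - a * c * q ^ Suc j) * (1 - a * d * q ^ Suc j) / (a * q ^ Suc j))
            - aw_coeff q n (a * s) (b * s) (c * s) (d * s) j
              * ((1 - a * b * c * d * q ^ j) / (a * q ^ j)))"
proof -
  define t where "t = a * b * c * d"
  have q: "q \<noteq> 0" using assms by simp
  have e: "a * s * (b * s) = a * b * q" "a * s * (c * s) = a * c * q" "a * s * (d * s) = a * d * q"
    by (simp_all add: assms power2_eq_square mult_ac)
  have t': "a * b * q * (c * s) * (d * s) * q ^ n / q = t * q ^ n * q"
    using q by (simp add: t_def assms(2) power2_eq_square field_simps)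
  define B where "B i k = qpoch (a * b * q ^ i) q k * qpoch (a * c * q ^ i) q k * qpoch (a * d * q ^ i) q k" for i k
  define L where "L i = qpoch (1 / q ^ n) q i * qpoch (t * q ^ n * q) q i / qpoch q q i" for i
  have coeff: "aw_coeff q n (a * s) (b * s) (c * s) (d * s) i = B (Suc i) (n - i) * L i * q ^ i / (a * s) ^ n" for i
    unfolding aw_coeff_def e t' by (simp add: B_def L_def mult_ac)
  have coeff': "aw_coeff q (Suc n) a b c d (Suc j) = B (Suc j) (n - j) *
      (qpoch (1 / q ^ Suc n) q (Suc j) * qpoch (t * q ^ n) q (Suc j) / qpoch q q (Suc j) * q ^ Suc j) / a ^ Suc n"
    using q by (simp add: aw_coeff_def B_def t_def mult_ac)
  have nz: "1 - q * q ^ j \<noteq> 0" "qpoch q q j \<noteq> 0"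
    by (rule one_minus_power_nonzero qpoch_nonzero; use assms in simp)+
  have key: "qpoch (1 / q ^ Suc n) q (Suc j) * qpoch (t * q ^ n) q (Suc j) / qpoch q q (Suc j) * q ^ Suc j
      = L (Suc j) - L j * (1 - t * q ^ j)"
  proof -
    have 1: "qpoch (1 / q ^ Suc n) q (Suc j) * qpoch (t * q ^ n) q (Suc j) / qpoch q q (Suc j) =
        L j * ((1 - 1 / q ^ Suc n) * (1 - t * q ^ n) / (1 - q * q ^ j))"
      unfolding qpoch_Suc_left[of "1 / q ^ Suc n"] qpoch_Suc_left[of "t * q ^ n"] qpoch_Suc[of q] L_def
      using q by (simp add: mult_ac)
    have 2: "L (Suc j) = L j * ((1 - q ^ j / q ^ n) * (1 - t * q ^ n * q * q ^ j) / (1 - q * q ^ j))"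
      unfolding L_def qpoch_Suc by simp
    have 3: "(1 - 1 / q ^ Suc n) * (1 - t * q ^ n) / (1 - q * q ^ j) * q ^ Suc j =
        (1 - q ^ j / q ^ n) * (1 - t * q ^ n * q * q ^ j) / (1 - q * q ^ j) - (1 - t * q ^ j)"
      using q nz by (simp add: field_simps)
    have 4: "l * e * p = l * u - l * v" if "e * p = u - v" for l e p u v :: complex
      by (simp add: mult.assoc that right_diff_distrib)
    show ?thesis
      unfolding 1 2 by (rule 4[OF 3])
  qed
  have X: "aw_coeff q n (a * s) (b * s) (c * s) (d * s) (Suc j)
      * ((1 - a * b * q ^ Suc j) * (1 - a * c * q ^ Suc j) * (1 - a * d * q ^ Suc j) / (a * q ^ Suc j))
      = B (Suc j) (n - j) * L (Suc j) / (a * (a * s) ^ n)"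
  \<comment> \<open>The next coefficient does not exist in degree \<open>n\<close>; its formal value is \<open>0\<close>.\<close>
  proof (cases "j = n")
    case True
    then have "L (Suc j) = 0" using q by (simp add: L_def qpoch_Suc)
    then show ?thesis by (simp add: coeff)
  next
    case False
    then have "n - j = Suc (n - Suc j)" using assms by simp
    then have "B (Suc j) (n - j) = (1 - a * b * q ^ Suc j) * (1 - a * c * q ^ Suc j) * (1 - a * d * q ^ Suc j)
        * B (Suc (Suc j)) (n - Suc j)"
      by (simp add: B_def qpoch_Suc_left mult_ac)
    then show ?thesis using q by (simp add: coeff) (simp add: mult_ac)
  qed
  have Y: "aw_coeff q n (a * s) (b * s) (c * s) (d * s) j * ((1 - a * b * c * d * q ^ j) / (a * q ^ j)) =
      B (Suc j) (n - j) * (L j * (1 - t * q ^ j)) / (a * (a * s) ^ n)"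
    using q by (simp add: coeff t_def)
  show ?thesis
    unfolding X Y coeff' key using assms(1)
    by (simp add: power_mult_distrib right_diff_distrib diff_divide_distrib mult.assoc)
qed

text \<open>
  The linear polynomial produced by the raising operator, expanded in \<open>1\<close> and
  \<open>(1 - a z) (1 - a / z)\<close>. With \<open>a q\<^sup>j\<close> in place of \<open>a\<close> it gives the action of the raising
  operator on the basis \<open>(az, a/z; q)\<^sub>j\<close>.
\<close>

lemma aw_weight_basis:
  assumes "z \<noteq> 0" "a \<noteq> 0" 
  shows "aw_weight (1 / z) a b c d - aw_weight z a b c d =
    (z - 1 / z) * ((1 - a * b) * (1 - a * c) * (1 - a * d) / a
       - (1 - a * b * c * d) / a * ((1 - a * z) * (1 - a / z)))"
proof -
  have "(1 - a * z) * (1 - a / z) = 1 + a\<^sup>2 - a * (z + 1 / z)"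
    using assms(1) by (simp add: algebra_simps power2_eq_square)
  then have "a * aw_linear z a b c d =
      (1 - a * b) * (1 - a * c) * (1 - a * d) - (1 - a * b * c * d) * ((1 - a * z) * (1 - a / z))"
    by (simp add: aw_linear_def algebra_simps power2_eq_square)
  then have "aw_linear z a b c d = (1 - a * b) * (1 - a * c) * (1 - a * d) / a
      - (1 - a * b * c * d) / a * ((1 - a * z) * (1 - a / z))"
    using assms(2) by (metis diff_divide_distrib nonzero_mult_div_cancel_left times_divide_eq_left)
  then show ?thesis
    by (simp only: aw_weight_diff[OF assms(1)])
qed

lemma aw_sum_raising:
  assumes "s \<noteq> 0" "q = s\<^sup>2" "norm q < 1" "z \<noteq> 0" "a \<noteq> 0"
  shows "(z - 1 / z) * aw_sum q (Suc n) z a b c d =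
     s ^ n * (aw_weight (1 / z) a b c d * aw_sum q n (z / s) (a * s) (b * s) (c * s) (d * s)
            - aw_weight z a b c d * aw_sum q n (s * z) (a * s) (b * s) (c * s) (d * s))"
proof -
  define C where "C j = aw_coeff q n (a * s) (b * s) (c * s) (d * s) j" for j
  define \<phi> where "\<phi> j = qpoch (a * z) q j * qpoch (a / z) q j" for j
  define X where "X j = C j * ((1 - a * b * q ^ j) * (1 - a * c * q ^ j) * (1 - a * d * q ^ j) / (a * q ^ j))" for j
  define Y where "Y j = C j * ((1 - a * b * c * d * q ^ j) / (a * q ^ j))" for j
  have q: "q \<noteq> 0" using assms by simp
  have basis: "aw_weight (1 / z) a b c d * (qpoch (a * z) q j * qpoch (a * q / z) q j)
      - aw_weight z a b c d * (qpoch (a * q * z) q j * qpoch (a / z) q j) =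
      (z - 1 / z) * ((1 - a * b * q ^ j) * (1 - a * c * q ^ j) * (1 - a * d * q ^ j) / (a * q ^ j) * \<phi> j
         - (1 - a * b * c * d * q ^ j) / (a * q ^ j) * \<phi> (Suc j))" for j
  proof -
    have w1: "aw_weight (1 / z) a b c d * qpoch (a * q / z) q j = aw_weight (1 / z) (a * q ^ j) b c d * qpoch (a / z) q j"
      using qpoch_Suc_left[of "a / z" q j] qpoch_Suc[of "a / z" q j] unfolding aw_weight_def by (simp add: mult_ac)
    have w2: "aw_weight z a b c d * qpoch (a * q * z) q j = aw_weight z (a * q ^ j) b c d * qpoch (a * z) q j"
      using qpoch_Suc_left[of "a * z" q j] qpoch_Suc[of "a * z" q j] unfolding aw_weight_def by (simp add: mult_ac)
    have "aw_weight (1 / z) a b c d * (qpoch (a * z) q j * qpoch (a * q / z) q j)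
      - aw_weight z a b c d * (qpoch (a * q * z) q j * qpoch (a / z) q j) =
      (aw_weight (1 / z) (a * q ^ j) b c d - aw_weight z (a * q ^ j) b c d) * \<phi> j"
      using w1 w2 unfolding \<phi>_def by algebra
    also have "\<dots> = (z - 1 / z) * ((1 - a * b * q ^ j) * (1 - a * c * q ^ j) * (1 - a * d * q ^ j) / (a * q ^ j)
       - (1 - a * b * c * d * q ^ j) / (a * q ^ j) * ((1 - a * q ^ j * z) * (1 - a * q ^ j / z))) * \<phi> j"
      by (subst aw_weight_basis) (use assms q in \<open>simp_all add: mult_ac\<close>)
    also have "\<dots> = (z - 1 / z) * ((1 - a * b * q ^ j) * (1 - a * c * q ^ j) * (1 - a * d * q ^ j) / (a * q ^ j) * \<phi> j
       - (1 - a * b * c * d * q ^ j) / (a * q ^ j) * ((1 - a * q ^ j * z) * (1 - a * q ^ j / z) * \<phi> j))"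
    proof -
      have "x * (g - h * e) * p = x * (g * p - h * (e * p))" for x g h e p :: complex
        by (simp add: algebra_simps)
      then show ?thesis .
    qed
    also have "(1 - a * q ^ j * z) * (1 - a * q ^ j / z) * \<phi> j = \<phi> (Suc j)"
      by (simp add: \<phi>_def qpoch_Suc mult_ac)
    finally show ?thesis .
  qed
  have args: "a * s * (z / s) = a * z" "a * s / (z / s) = a * q / z" "a * s * (s * z) = a * q * z"
    "a * s / (s * z) = a / z"
    using assms(1,4) by (simp_all add: assms(2) power2_eq_square)
  have top: "X (Suc n) = 0"
    using aw_coeff_top[OF q] by (simp add: X_def C_def)
  have "aw_sum q (Suc n) z a b c d = (\<Sum>j\<le>Suc n. aw_coeff q (Suc n) a b c d j * \<phi> j)"
    by (simp only: aw_sum_def \<phi>_def)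
  also have "\<dots> = aw_coeff q (Suc n) a b c d 0 * \<phi> 0 + (\<Sum>j\<le>n. aw_coeff q (Suc n) a b c d (Suc j) * \<phi> (Suc j))"
    by (rule sum.atMost_Suc_shift)
  also have "aw_coeff q (Suc n) a b c d 0 = s ^ n * X 0"
    using aw_coeff_raise_0[OF assms(1,2)] by (simp add: X_def C_def)
  also have "(\<Sum>j\<le>n. aw_coeff q (Suc n) a b c d (Suc j) * \<phi> (Suc j)) =
      (\<Sum>j\<le>n. s ^ n * (X (Suc j) - Y j) * \<phi> (Suc j))"
    by (intro sum.cong refl) (use assms in \<open>simp add: aw_coeff_raise_Suc X_def Y_def C_def\<close>)
  also have "s ^ n * X 0 * \<phi> 0 + (\<Sum>j\<le>n. s ^ n * (X (Suc j) - Y j) * \<phi> (Suc j)) =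
      s ^ n * ((X 0 * \<phi> 0 + (\<Sum>j\<le>n. X (Suc j) * \<phi> (Suc j))) - (\<Sum>j\<le>n. Y j * \<phi> (Suc j)))"
    by (simp add: sum_distrib_left sum_subtractf algebra_simps)
  also have "X 0 * \<phi> 0 + (\<Sum>j\<le>n. X (Suc j) * \<phi> (Suc j)) = (\<Sum>j\<le>Suc n. X j * \<phi> j)"
    by (rule sum.atMost_Suc_shift[symmetric])
  also have "\<dots> = (\<Sum>j\<le>n. X j * \<phi> j)"
    by (simp add: top)
  finally have expand: "aw_sum q (Suc n) z a b c d = s ^ n * ((\<Sum>j\<le>n. X j * \<phi> j) - (\<Sum>j\<le>n. Y j * \<phi> (Suc j)))" .
  have "(z - 1 / z) * aw_sum q (Suc n) z a b c d =
      s ^ n * (\<Sum>j\<le>n. C j * ((z - 1 / z) * ((1 - a * b * q ^ j) * (1 - a * c * q ^ j) * (1 - a * d * q ^ j) / (a * q ^ j) * \<phi> j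
         - (1 - a * b * c * d * q ^ j) / (a * q ^ j) * \<phi> (Suc j))))"
  proof -
    have "x * (r * (c' * g * p - c' * h * p')) = r * (c' * (x * (g * p - h * p')))" for x r c' g h p p' :: complex
      by (simp add: algebra_simps)
    then show ?thesis
      unfolding expand X_def Y_def sum_subtractf[symmetric] sum_distrib_left
      by (intro sum.cong refl)
  qed
  also have "\<dots> = s ^ n * (\<Sum>j\<le>n. C j * (aw_weight (1 / z) a b c d * (qpoch (a * z) q j * qpoch (a * q / z) q j)
      - aw_weight z a b c d * (qpoch (a * q * z) q j * qpoch (a / z) q j)))"
    unfolding basis ..
  also have "\<dots> = s ^ n * (aw_weight (1 / z) a b c d * aw_sum q n (z / s) (a * s) (b * s) (c * s) (d * s)
            - aw_weight z a b c d * aw_sum q n (s * z) (a * s) (b * s) (c * s) (d * s))"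
  proof -
    have "c' * (v * p - w * p') = v * (c' * p) - w * (c' * p')" for c' v w p p' :: complex
      by (simp add: algebra_simps)
    then show ?thesis
      unfolding aw_sum_def args C_def[symmetric] sum_distrib_left[of "aw_weight _ _ _ _ _"] sum_subtractf[symmetric]
      by simp
  qed
  finally show ?thesis .
qed

section \<open>Identification with the Askey-Wilson polynomials\<close>

lemma continuous_on_aw_poly:
  assumes "s \<noteq> 0" "\<And>x. x \<in> S \<Longrightarrow> z x \<noteq> 0"
    and "continuous_on S z" "continuous_on S a" "continuous_on S b" "continuous_on S c" "continuous_on S d"
  shows "continuous_on S (\<lambda>x. aw_poly s n (z x) (a x) (b x) (c x) (d x))"
  using assms(2-)
proof (induction n arbitrary: z a b c d rule: less_induct)
  case (less n)
  show ?case
  proof (cases n)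
    case (Suc m)
    have "continuous_on S (\<lambda>x. aw_linear (z x) (a x) (b x) (c x) (d x))"
      unfolding aw_linear_def using less.prems by (intro continuous_intros) auto
    moreover have "continuous_on S (\<lambda>x. aw_weight (z x) (a x) (b x) (c x) (d x))"
      unfolding aw_weight_def using less.prems by (intro continuous_intros) auto
    moreover have "continuous_on S (\<lambda>x. aw_poly s m (z x / s) (a x * s) (b x * s) (c x * s) (d x * s))"
      using less.prems assms(1) Suc by (intro less.IH continuous_intros) auto
    moreover have "continuous_on S (\<lambda>x. aw_poly s (m - 1) (z x) (a x * s\<^sup>2) (b x * s\<^sup>2) (c x * s\<^sup>2) (d x * s\<^sup>2))"
      using less.prems Suc by (intro less.IH continuous_intros) auto
    ultimately show ?thesis
      unfolding Suc aw_poly.simps by (intro continuous_intros less.prems)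
  qed simp
qed

text \<open>
  Relations obtained from the raising operator carry the factor \<open>z - 1 / z\<close>; continuity recovers
  them at its zeros \<open>1\<close> and \<open>-1\<close>.
\<close>

lemma cancel_antisymmetric_factor:
  fixes f g :: "complex \<Rightarrow> complex"
  assumes "continuous_on (- {0}) f" "continuous_on (- {0}) g"
    and eq: "\<And>z. z \<noteq> 0 \<Longrightarrow> (z - 1 / z) * f z = (z - 1 / z) * g z"
    and "z \<noteq> 0"
  shows "f z = g z"
proof -
  define h where "h w = f w - g w" for w
  have "continuous_on (- {0}) h"
    unfolding h_def by (intro continuous_intros assms)
  then have "isCont h z"
    using \<open>z \<noteq> 0\<close> by (simp add: continuous_on_eq_continuous_at[OF open_Compl[OF closed_singleton]])
  then have "(h \<longlongrightarrow> h z) (at z)"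
    by (simp add: isCont_def)
  moreover have "eventually (\<lambda>w. h w = 0) (at z)"
  proof -
    have "eventually (\<lambda>w. w \<in> - ({0, 1, -1} - {z})) (at z)"
      by (intro eventually_at_in_open' open_Compl finite_imp_closed) auto
    moreover have "eventually (\<lambda>w. w \<noteq> z) (at z)"
      by (rule eventually_neq_at_within)
    ultimately show ?thesis
    proof eventually_elim
      case (elim w)
      then have "w \<noteq> 0" "w \<noteq> 1" "w \<noteq> -1"
        using \<open>z \<noteq> 0\<close> by auto
      then have "w - 1 / w \<noteq> 0"
        by (auto simp: divide_eq_eq eq_divide_eq square_eq_1_iff)
      then show ?case
        using eq[OF \<open>w \<noteq> 0\<close>] by (simp add: h_def)
    qed
  qed
  then have "(h \<longlongrightarrow> 0) (at z)"
    by (rule tendsto_eventually)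
  ultimately have "h z = 0"
    by (rule tendsto_unique[OF at_neq_bot])
  then show ?thesis by (simp add: h_def)
qed

lemma continuous_on_aw_sum: "continuous_on (- {0}) (\<lambda>z. aw_sum q n z a b c d)"
  unfolding aw_sum_def qpoch_def by (intro continuous_intros) auto

text \<open>
  Both sides satisfy the raising relation, which determines each degree from the previous one.
\<close>

lemma aw_sum_eq_aw_poly:
  assumes "s \<noteq> 0" "q = s\<^sup>2" "norm q < 1" "z \<noteq> 0" "a \<noteq> 0"
  shows "aw_sum q n z a b c d = aw_poly s n z a b c d"
  using assms(4,5)
proof (induction n arbitrary: z a b c d)
  case 0
  show ?case by (simp add: aw_sum_def aw_coeff_def)
next
  case (Suc n)
  show ?case
  proof (rule cancel_antisymmetric_factor[where f = "\<lambda>z. aw_sum q (Suc n) z a b c d", OF _ _ _ Suc.prems(1)])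
    show "continuous_on (- {0}) (\<lambda>z. aw_poly s (Suc n) z a b c d)"
      using assms(1) by (intro continuous_on_aw_poly continuous_intros) auto
    fix w :: complex assume "w \<noteq> 0"
    then show "(w - 1 / w) * aw_sum q (Suc n) w a b c d = (w - 1 / w) * aw_poly s (Suc n) w a b c d"
      unfolding aw_sum_raising[OF assms(1-3) \<open>w \<noteq> 0\<close> Suc.prems(2)] aw_raising[OF assms(1) \<open>w \<noteq> 0\<close>]
      using assms(1) Suc.prems(2) by (simp add: Suc.IH)
  qed (rule continuous_on_aw_sum)
qed

lemma norm_mult_less_1: "norm x < 1 \<Longrightarrow> norm y < 1 \<Longrightarrow> norm (x * y :: complex) < 1"
  by (metis norm_mult norm_ge_zero mult_strict_mono' mult_1)

text \<open>
  For \<open>a\<close> near \<open>0\<close> but different from \<open>0\<close> the series equals \<open>aw_poly\<close>, whose continuity in \<open>a\<close>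
  gives the existence and the value of the limit in the definition of the polynomials at \<open>a = 0\<close>.
\<close>

lemma askey_wilson_eq_aw_poly:
  assumes "s \<noteq> 0" "q = s\<^sup>2" "norm q < 1" "z \<noteq> 0"
    and "norm a < 1" "norm b < 1" "norm c < 1" "norm d < 1"
  shows "askey_wilson n ((z + inverse z) / 2) a b c d q = aw_poly s n z a b c d"
proof -
  have series: "aw_series n z a' b c d q = aw_poly s n z a' b c d" if "a' \<noteq> 0" "norm a' < 1" for a'
  proof -
    have "q \<noteq> 0" using assms by simp
    then have "aw_series n z a' b c d q = aw_sum q n z a' b c d"
      using assms that by (intro aw_series_eq_aw_sum norm_mult_less_1)
    also have "\<dots> = aw_poly s n z a' b c d"
      using assms that by (intro aw_sum_eq_aw_poly)
    finally show ?thesis .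
  qed
  have "((\<lambda>a'. aw_series n z a' b c d q) \<longlongrightarrow> aw_poly s n z 0 b c d) (at 0)"
  proof (rule Lim_transform_eventually)
    have "continuous_on UNIV (\<lambda>a'. aw_poly s n z a' b c d)"
      using assms by (intro continuous_on_aw_poly continuous_intros) auto
    then have "isCont (\<lambda>a'. aw_poly s n z a' b c d) 0"
      by (simp add: continuous_on_eq_continuous_at)
    then show "((\<lambda>a'. aw_poly s n z a' b c d) \<longlongrightarrow> aw_poly s n z 0 b c d) (at 0)"
      by (simp add: isCont_def)
    have "eventually (\<lambda>a'. a' \<in> ball 0 1) (at (0 :: complex))"
      by (rule eventually_at_in_open') auto
    moreover have "eventually (\<lambda>a'. a' \<noteq> 0) (at (0 :: complex))"
      by (rule eventually_neq_at_within)
    ultimately show "eventually (\<lambda>a'. aw_poly s n z a' b c d = aw_series n z a' b c d q) (at 0)"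
      by eventually_elim (simp add: series)
  qed
  then have "Lim (at 0) (\<lambda>a'. aw_series n z a' b c d q) = aw_poly s n z 0 b c d"
    by (intro tendsto_Lim) auto
  then show ?thesis
    using series[of a] assms by (simp add: askey_wilson_joukowski)
qed

section \<open>Gaussian binomial coefficients\<close>

text \<open>
  The product \<open>(1 - q\<^sup>n) (1 - q\<^sup>n\<^sup>-\<^sup>1) \<dots>\<close> with \<open>k\<close> factors. Truncated subtraction is the right convention:
  for \<open>k > n\<close> the factor of index \<open>n\<close> vanishes.
\<close>

definition qfall :: "complex \<Rightarrow> nat \<Rightarrow> nat \<Rightarrow> complex" where
  "qfall q n k = (\<Prod>i<k. 1 - q ^ (n - i))"

definition qbinom :: "complex \<Rightarrow> nat \<Rightarrow> nat \<Rightarrow> complex" where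
  "qbinom q n k = qfall q n k / qpoch q q k"

lemma qfall_0 [simp]: "qfall q n 0 = 1"
  by (simp add: qfall_def)

lemma qfall_Suc: "qfall q n (Suc k) = qfall q n k * (1 - q ^ (n - k))"
  by (simp add: qfall_def)

lemma qfall_Suc_left: "qfall q (Suc n) (Suc k) = (1 - q ^ Suc n) * qfall q n k"
  unfolding qfall_def by (subst prod.lessThan_Suc_shift) simp

lemma qfall_eq_0: "n < k \<Longrightarrow> qfall q n k = 0"
  by (auto simp: qfall_def intro!: bexI[of _ n])

lemma qbinom_0 [simp]: "qbinom q n 0 = 1"
  by (simp add: qbinom_def)

lemma qbinom_eq_0: "n < k \<Longrightarrow> qbinom q n k = 0"
  by (simp add: qbinom_def qfall_eq_0)

lemma qbinom_Suc:
  assumes "norm q < 1" "k \<le> n"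
  shows "qbinom q (Suc n) (Suc k) = q ^ Suc k * qbinom q n (Suc k) + qbinom q n k" (is ?A)
    and "qbinom q (Suc n) (Suc k) = qbinom q n (Suc k) + q ^ (n - k) * qbinom q n k" (is ?B)
proof -
  have nz: "1 - q * q ^ k \<noteq> 0"
    by (rule one_minus_power_nonzero[OF assms(1)])
  have l: "qbinom q (Suc n) (Suc k) = qbinom q n k * ((1 - q ^ Suc n) / (1 - q * q ^ k))"
    and r: "qbinom q n (Suc k) = qbinom q n k * ((1 - q ^ (n - k)) / (1 - q * q ^ k))"
    unfolding qbinom_def qfall_Suc_left by (simp_all add: qfall_Suc qpoch_Suc)
  have p: "q ^ Suc n = q * q ^ k * q ^ (n - k)"
    using assms(2) by (simp add: mult.assoc flip: power_add)
  have A: "(1 - q ^ Suc n) / (1 - q * q ^ k) = q ^ Suc k * ((1 - q ^ (n - k)) / (1 - q * q ^ k)) + 1"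
    and B: "(1 - q ^ Suc n) / (1 - q * q ^ k) = (1 - q ^ (n - k)) / (1 - q * q ^ k) + q ^ (n - k)"
    using nz unfolding p by (simp_all add: field_simps)
  show ?A ?B
    unfolding l r by (subst A, simp add: algebra_simps) (subst B, simp add: algebra_simps)
qed

section \<open>The addition formula in the degree\<close>

text \<open>
  Up to a power of \<open>q\<close>, the product of \<open>aw_weight\<close> over the first \<open>k\<close> simultaneous half-steps of
  \<open>z\<close> and the parameters.
\<close>

definition aw_factor ::
  "complex \<Rightarrow> nat \<Rightarrow> complex \<Rightarrow> complex \<Rightarrow> complex \<Rightarrow> complex \<Rightarrow> complex \<Rightarrow> complex" where
  "aw_factor q k z a b c d =
     qpoch (a * z) q k * qpoch (b * z) q k * qpoch (c * z) q k * qpoch (d * z) q k / z ^ (2 * k)"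

lemma aw_factor_0 [simp]: "aw_factor q 0 z a b c d = 1"
  by (simp add: aw_factor_def)

lemma aw_factor_Suc:
  assumes "s \<noteq> 0" "q = s\<^sup>2"
  shows "aw_factor q (Suc k) z a b c d =
    q ^ k * (aw_factor q k z a b c d * aw_weight (s ^ k * z) (a * s ^ k) (b * s ^ k) (c * s ^ k) (d * s ^ k))"
proof -
  have "x * s ^ k * (s ^ k * z) = x * z * q ^ k" for x
    by (simp add: assms(2) power2_eq_square power_mult_distrib mult_ac)
  moreover have "(s ^ k * z)\<^sup>2 = q ^ k * z\<^sup>2"
    by (simp add: assms(2) power2_eq_square power_mult_distrib mult_ac)
  moreover have "z ^ (2 * Suc k) = z ^ (2 * k) * z\<^sup>2"
    by (simp add: power2_eq_square mult_ac)
  ultimately show ?thesis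
    unfolding aw_factor_def aw_weight_def qpoch_Suc using assms by (simp only:) (simp add: mult_ac)
qed

text \<open>
  This lemma and the next say that multiplication by \<open>aw_factor\<close> intertwines the raising
  operator at \<open>(z, a, b, c, d)\<close> with the one at \<open>(s\<^sup>k z, a s\<^sup>k, b s\<^sup>k, c s\<^sup>k, d s\<^sup>k)\<close>. It is the reason why
  the raising operator applied to a summand of the formula gives a summand of the same shape.
\<close>

lemma aw_factor_up:
  assumes "s \<noteq> 0" "q = s\<^sup>2"
  shows "aw_weight z a b c d * aw_factor q k (s * z) (a * s) (b * s) (c * s) (d * s) =
    aw_factor q k z a b c d * aw_weight (s ^ k * z) (a * s ^ k) (b * s ^ k) (c * s ^ k) (d * s ^ k)"
proof -
  have w: "(1 - x * z) * qpoch (x * s * (s * z)) q k = qpoch (x * z) q (Suc k)" for x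
    unfolding qpoch_Suc_left by (simp add: assms(2) power2_eq_square mult_ac)
  have p: "(s * z) ^ (2 * k) = q ^ k * z ^ (2 * k)"
    by (simp add: assms(2) power_mult_distrib power_mult)
  have "q ^ k * (aw_weight z a b c d * aw_factor q k (s * z) (a * s) (b * s) (c * s) (d * s)) =
      ((1 - a * z) * qpoch (a * s * (s * z)) q k) * ((1 - b * z) * qpoch (b * s * (s * z)) q k)
      * ((1 - c * z) * qpoch (c * s * (s * z)) q k) * ((1 - d * z) * qpoch (d * s * (s * z)) q k)
      / (z\<^sup>2 * z ^ (2 * k))"
    unfolding aw_weight_def aw_factor_def p using assms by (simp add: mult_ac)
  also have "\<dots> = aw_factor q (Suc k) z a b c d"
    unfolding w by (simp add: aw_factor_def power2_eq_square mult_ac)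
  finally show ?thesis
    unfolding aw_factor_Suc[OF assms] using assms by simp
qed

lemma aw_factor_down:
  assumes "s \<noteq> 0" "q = s\<^sup>2"
  shows "aw_weight (1 / z) a b c d * aw_factor q k (z / s) (a * s) (b * s) (c * s) (d * s) =
    aw_factor q k z a b c d * aw_weight (1 / (s ^ k * z)) (a * s ^ k) (b * s ^ k) (c * s ^ k) (d * s ^ k)"
  unfolding aw_weight_def aw_factor_def using assms
  by (simp add: power_divide power_mult_distrib) (simp add: mult_ac flip: power_mult)

text \<open>
  The \<open>q\<close>-Leibniz rule on one summand \<open>F\<close> of the formula for \<open>n + m\<close>. The numerator of the raising
  operator on a product \<open>p g\<close> is the numerator for \<open>p\<close> times \<open>g (y / s)\<close>, minus a term with the
  difference \<open>g (s y) - g (y / s)\<close>. The first part raises the degree of \<open>p\<close> and stays at index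
  \<open>k\<close>; in the second part the difference lowers the degree of \<open>g\<close> and the weight is absorbed into
  \<open>aw_factor\<close>, which moves to index \<open>k + 1\<close>.
\<close>

lemma aw_poly_add_step:
  fixes n m k :: nat and s q z a b c d :: complex
  assumes s: "s \<noteq> 0" and q: "q = s\<^sup>2" and "z \<noteq> 0" and "k \<le> n"
  defines "T \<equiv> qpoch (a * b * c * d * q ^ (2 * Suc n + m) / q) q"
  defines "P \<equiv> \<lambda>k. aw_poly s (Suc n - k) (s ^ k * z) (a * s ^ k) (b * s ^ k) (c * s ^ k) (d * s ^ k)"
  defines "G \<equiv> \<lambda>k. aw_poly s (m - k) (s ^ k * z / s ^ Suc n)
     (a * s ^ (k + Suc n)) (b * s ^ (k + Suc n)) (c * s ^ (k + Suc n)) (d * s ^ (k + Suc n))"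
  defines "E \<equiv> \<lambda>k. s ^ (m * (Suc n - k)) * qfall q m k * T k * aw_factor q k z a b c d * P k * G k"
  defines "F \<equiv> \<lambda>w. s ^ (m * (n - k)) * qfall q m k * T k * aw_factor q k w (a * s) (b * s) (c * s) (d * s)
     * aw_poly s (n - k) (s ^ k * w) (a * s * s ^ k) (b * s * s ^ k) (c * s * s ^ k) (d * s * s ^ k)
     * aw_poly s (m - k) (s ^ k * w / s ^ n)
         (a * s * s ^ (k + n)) (b * s * s ^ (k + n)) (c * s * s ^ (k + n)) (d * s * s ^ (k + n))"
  shows "s ^ (n + m) * (aw_weight (1 / z) a b c d * F (z / s) - aw_weight z a b c d * F (s * z)) =
     (q ^ k * z - 1 / z) * E k + (z - q ^ (n - k) / z) * E (Suc k)"
proof -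
  define t where "t = a * b * c * d"
  define u where "u = s ^ k * z"
  define y where "y = u / s ^ n"
  define p where "p w = aw_poly s (n - k) w (a * s ^ Suc k) (b * s ^ Suc k) (c * s ^ Suc k) (d * s ^ Suc k)" for w
  define g where "g w = aw_poly s (m - k) w
     (a * s ^ (k + Suc n)) (b * s ^ (k + Suc n)) (c * s ^ (k + Suc n)) (d * s ^ (k + Suc n))" for w
  define V where "V w = aw_weight w (a * s ^ k) (b * s ^ k) (c * s ^ k) (d * s ^ k)" for w
  define W where "W k = aw_factor q k z a b c d" for k
  have nz: "u \<noteq> 0" "y \<noteq> 0" "q \<noteq> 0"
    using assms(1,2,3) by (simp_all add: u_def y_def)
  have F: "F w = s ^ (m * (n - k)) * qfall q m k * T k * aw_factor q k w (a * s) (b * s) (c * s) (d * s)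
      * p (s ^ k * w) * g (s ^ k * w / s ^ n)" for w
    by (simp add: F_def p_def g_def mult_ac)
  have down: "aw_weight (1 / z) a b c d * F (z / s) =
      s ^ (m * (n - k)) * qfall q m k * T k * W k * (V (1 / u) * p (u / s) * g (y / s))"
  proof -
    have e: "s ^ k * (z / s) = u / s" "u / s / s ^ n = y / s"
      by (simp_all add: u_def y_def)
    show ?thesis
      using aw_factor_down[OF s q, of z a b c d k]
      unfolding F e W_def V_def u_def[symmetric] by (simp add: mult_ac)
  qed
  have up: "aw_weight z a b c d * F (s * z) =
      s ^ (m * (n - k)) * qfall q m k * T k * W k * (V u * p (s * u) * g (s * y))"
  proof -
    have e: "s ^ k * (s * z) = s * u" "s * u / s ^ n = s * y"
      by (simp_all add: u_def y_def)
    show ?thesis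
      using aw_factor_up[OF s q, of z a b c d k]
      unfolding F e W_def V_def u_def[symmetric] by (simp add: mult_ac)
  qed
  have raise: "s ^ (n - k) * (V (1 / u) * p (u / s) - V u * p (s * u)) = (u - 1 / u) * P k"
  proof -
    have "P k = aw_poly s (Suc (n - k)) u (a * s ^ k) (b * s ^ k) (c * s ^ k) (d * s ^ k)"
      using \<open>k \<le> n\<close> by (simp add: P_def u_def Suc_diff_le)
    then show ?thesis
      using aw_raising[OF s nz(1), of "n - k" "a * s ^ k" "b * s ^ k" "c * s ^ k" "d * s ^ k"]
      by (simp add: p_def V_def mult_ac del: aw_poly.simps)
  qed
  have lower: "qfall q m k * T k * (s ^ (m - k) * (g (s * y) - g (y / s))) =
      - (qfall q m (Suc k) * T (Suc k) * ((y - 1 / y) * G (Suc k)))"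
  \<comment> \<open>For \<open>k \<ge> m\<close> both sides are zero: \<open>g\<close> is constant if \<open>k = m\<close>, and \<open>qfall\<close> vanishes beyond.\<close>
  proof (cases "k < m")
    case True
    then obtain l where l: "m = Suc (k + l)"
      using less_iff_Suc_add by auto
    have "s ^ Suc l * (g (s * y) - g (y / s)) = (s ^ (2 * Suc l) - 1)
        * (1 - a * s ^ (k + Suc n) * (b * s ^ (k + Suc n)) * (c * s ^ (k + Suc n)) * (d * s ^ (k + Suc n)) * s ^ (2 * l))
        * ((y - 1 / y) * G (Suc k))"
    proof -
      have "s ^ k * z * s / (s ^ n * s) = y"
        using s by (simp add: y_def u_def)
      then have G: "G (Suc k) = aw_poly s l y (a * s ^ (k + Suc n) * s) (b * s ^ (k + Suc n) * s)
          (c * s ^ (k + Suc n) * s) (d * s ^ (k + Suc n) * s)"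
        by (simp add: G_def l mult_ac)
      show ?thesis
        unfolding G g_def using s
          aw_lowering[OF s nz(2), of "Suc l" "a * s ^ (k + Suc n)" "b * s ^ (k + Suc n)" "c * s ^ (k + Suc n)" "d * s ^ (k + Suc n)"]
        by (simp add: l mult.assoc del: aw_poly.simps)
    qed
    also have "s ^ (2 * Suc l) = q ^ (m - k)"
    proof -
      have "m - k = Suc l" by (simp add: l)
      then show ?thesis by (simp only: q power_mult)
    qed
    also have "a * s ^ (k + Suc n) * (b * s ^ (k + Suc n)) * (c * s ^ (k + Suc n)) * (d * s ^ (k + Suc n)) * s ^ (2 * l)
        = t * q ^ (2 * Suc n + m) / q * q ^ k"
    proof -
      have "a * s ^ (k + Suc n) * (b * s ^ (k + Suc n)) * (c * s ^ (k + Suc n)) * (d * s ^ (k + Suc n)) * s ^ (2 * l) * q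
        = t * (s ^ (k + Suc n) * s ^ (k + Suc n) * s ^ (k + Suc n) * s ^ (k + Suc n) * s ^ (2 * l) * q)"
        by (simp add: t_def mult_ac)
      also have "s ^ (k + Suc n) * s ^ (k + Suc n) * s ^ (k + Suc n) * s ^ (k + Suc n) * s ^ (2 * l) * q
         = q ^ (2 * Suc n + m) * q ^ k"
        unfolding q l by (simp flip: power_add power_mult power_Suc add: algebra_simps)
      finally show ?thesis using nz by (simp add: field_simps)
    qed
    finally have "s ^ Suc l * (g (s * y) - g (y / s)) =
       (q ^ (m - k) - 1) * (1 - t * q ^ (2 * Suc n + m) / q * q ^ k) * ((y - 1 / y) * G (Suc k))" .
    moreover have "Suc l = m - k" by (simp add: l)
    ultimately have g: "s ^ (m - k) * (g (s * y) - g (y / s)) =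
       (q ^ (m - k) - 1) * (1 - t * q ^ (2 * Suc n + m) / q * q ^ k) * ((y - 1 / y) * G (Suc k))"
      by simp
    have T: "T (Suc k) = T k * (1 - t * q ^ (2 * Suc n + m) / q * q ^ k)"
      by (simp only: T_def qpoch_Suc t_def)
    have "f * x * ((v - 1) * w * h) = - (f * (1 - v) * (x * w) * h)" for f x v w h :: complex
      by (simp add: algebra_simps)
    then show ?thesis
      unfolding g T qfall_Suc .
  next
    case False
    then show ?thesis
      by (cases "k = m") (simp_all add: g_def qfall_eq_0)
  qed
  have Wv: "W (Suc k) = q ^ k * (W k * V u)"
    unfolding W_def V_def u_def by (rule aw_factor_Suc[OF s q])
  have pP: "p (s * u) = P (Suc k)"
    by (simp add: p_def P_def u_def mult_ac)
  have gG: "g (y / s) = G k"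
    by (simp add: g_def G_def y_def u_def mult_ac)
  have first: "s ^ (n + m) * s ^ (m * (n - k)) = s ^ (m * (Suc n - k)) * s ^ k * s ^ (n - k)"
    using \<open>k \<le> n\<close> by (simp add: Suc_diff_le flip: power_add) (simp add: add_ac)
  have second: "s ^ (n + m) * s ^ (m * (n - k)) = s ^ (m * (n - k)) * s ^ (n - k) * q ^ k * s ^ (m - k)"
    if "k \<le> m"
  proof -
    have "n + m = n - k + (2 * k + (m - k))"
      using \<open>k \<le> n\<close> that by simp
    then have "s ^ (n + m) = s ^ (n - k) * (q ^ k * s ^ (m - k))"
      unfolding q by (metis power_add power_mult)
    then show ?thesis by (simp add: mult_ac)
  qed
  have su: "s ^ k * (u - 1 / u) = q ^ k * z - 1 / z"
    using s by (simp add: u_def q power2_eq_square power_mult_distrib algebra_simps)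
  have sy: "s ^ (n - k) * (y - 1 / y) = z - q ^ (n - k) / z"
  proof -
    have "s ^ n = s ^ (n - k) * s ^ k"
      using \<open>k \<le> n\<close> by (simp flip: power_add)
    then have "y = z / s ^ (n - k)"
      using s by (simp add: y_def u_def)
    then show ?thesis
      using s by (simp add: q power2_eq_square power_mult_distrib algebra_simps)
  qed
  have "s ^ (n + m) * (aw_weight (1 / z) a b c d * F (z / s) - aw_weight z a b c d * F (s * z)) =
      s ^ (n + m) * s ^ (m * (n - k)) * qfall q m k * T k * W k *
        ((V (1 / u) * p (u / s) - V u * p (s * u)) * g (y / s))
    - s ^ (n + m) * s ^ (m * (n - k)) * qfall q m k * T k * W k * V u * p (s * u) * (g (s * y) - g (y / s))"
    unfolding down up by (simp add: algebra_simps)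
  also have "s ^ (n + m) * s ^ (m * (n - k)) * qfall q m k * T k * W k *
        ((V (1 / u) * p (u / s) - V u * p (s * u)) * g (y / s)) =
      s ^ (m * (Suc n - k)) * s ^ k * qfall q m k * T k * W k *
        ((s ^ (n - k) * (V (1 / u) * p (u / s) - V u * p (s * u))) * g (y / s))"
    unfolding first by (simp only: mult_ac)
  also have "\<dots> = (s ^ k * (u - 1 / u)) * E k"
    unfolding raise gG E_def W_def by (simp only: mult_ac)
  also have "s ^ (n + m) * s ^ (m * (n - k)) * qfall q m k * T k * W k * V u * p (s * u) * (g (s * y) - g (y / s)) =
      - ((s ^ (n - k) * (y - 1 / y)) * E (Suc k))"
  proof (cases "k \<le> m")
    case True
    have "s ^ (n + m) * s ^ (m * (n - k)) * qfall q m k * T k * W k * V u * p (s * u) * (g (s * y) - g (y / s)) =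
       s ^ (m * (n - k)) * s ^ (n - k) * (q ^ k * (W k * V u)) * p (s * u) *
         (qfall q m k * T k * (s ^ (m - k) * (g (s * y) - g (y / s))))"
      unfolding second[OF True] by (simp only: mult_ac)
    also have "\<dots> = - ((s ^ (n - k) * (y - 1 / y)) * E (Suc k))"
      unfolding lower Wv[symmetric]
      unfolding pP E_def W_def diff_Suc_Suc mult_minus_right by (simp only: mult_ac)
    finally show ?thesis .
  next
    case False
    then show ?thesis by (simp add: E_def qfall_eq_0)
  qed
  finally show ?thesis
    unfolding su sy by simp
qed

text \<open>
  Induction on \<open>n\<close>: the raising relation writes degree \<open>n + 1 + m\<close> as the raising operator applied
  to degree \<open>n + m\<close>, whose expansion is raised term by term. Each index \<open>k + 1\<close> then receives two
  contributions. Their coefficients of \<open>z\<close> and of \<open>1 / z\<close> are added up by the two forms of the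
  Pascal rule, respectively, which produces the common factor \<open>z - 1 / z\<close>.
\<close>

theorem aw_poly_add:
  assumes s: "s \<noteq> 0" and q: "q = s\<^sup>2" "norm q < 1" and "z \<noteq> 0"
  shows "aw_poly s (n + m) z a b c d =
    (\<Sum>k\<le>n. qbinom q n k * (s ^ (m * (n - k)) * qfall q m k * qpoch (a * b * c * d * q ^ (2 * n + m) / q) q k
      * aw_factor q k z a b c d
      * aw_poly s (n - k) (s ^ k * z) (a * s ^ k) (b * s ^ k) (c * s ^ k) (d * s ^ k)
      * aw_poly s (m - k) (s ^ k * z / s ^ n)
          (a * s ^ (k + n)) (b * s ^ (k + n)) (c * s ^ (k + n)) (d * s ^ (k + n))))"
  using \<open>z \<noteq> 0\<close>
proof (induction n arbitrary: z a b c d)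
  case 0
  show ?case by simp
next
  case (Suc n)
  define R where "R z = (\<Sum>k\<le>Suc n. qbinom q (Suc n) k * (s ^ (m * (Suc n - k)) * qfall q m k
      * qpoch (a * b * c * d * q ^ (2 * Suc n + m) / q) q k * aw_factor q k z a b c d
      * aw_poly s (Suc n - k) (s ^ k * z) (a * s ^ k) (b * s ^ k) (c * s ^ k) (d * s ^ k)
      * aw_poly s (m - k) (s ^ k * z / s ^ Suc n) (a * s ^ (k + Suc n)) (b * s ^ (k + Suc n))
          (c * s ^ (k + Suc n)) (d * s ^ (k + Suc n))))" for z
  have "aw_poly s (Suc (n + m)) z a b c d = R z"
  proof (rule cancel_antisymmetric_factor[where f = "\<lambda>z. aw_poly s (Suc (n + m)) z a b c d", OF _ _ _ Suc.prems])
    show "continuous_on (- {0}) (\<lambda>z. aw_poly s (Suc (n + m)) z a b c d)"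
      using s by (intro continuous_on_aw_poly continuous_intros) auto
    show "continuous_on (- {0}) R"
      unfolding R_def aw_factor_def qpoch_def
      using s by (intro continuous_intros continuous_on_aw_poly) auto
    fix w :: complex assume w: "w \<noteq> 0"
    define E where "E k = s ^ (m * (Suc n - k)) * qfall q m k
      * qpoch (a * b * c * d * q ^ (2 * Suc n + m) / q) q k * aw_factor q k w a b c d
      * aw_poly s (Suc n - k) (s ^ k * w) (a * s ^ k) (b * s ^ k) (c * s ^ k) (d * s ^ k)
      * aw_poly s (m - k) (s ^ k * w / s ^ Suc n) (a * s ^ (k + Suc n)) (b * s ^ (k + Suc n))
          (c * s ^ (k + Suc n)) (d * s ^ (k + Suc n))" for k
    define F where "F k v = s ^ (m * (n - k)) * qfall q m k
       * qpoch (a * b * c * d * q ^ (2 * Suc n + m) / q) q k * aw_factor q k v (a * s) (b * s) (c * s) (d * s)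
       * aw_poly s (n - k) (s ^ k * v) (a * s * s ^ k) (b * s * s ^ k) (c * s * s ^ k) (d * s * s ^ k)
       * aw_poly s (m - k) (s ^ k * v / s ^ n)
         (a * s * s ^ (k + n)) (b * s * s ^ (k + n)) (c * s * s ^ (k + n)) (d * s * s ^ (k + n))" for k v
    have IH: "aw_poly s (n + m) v (a * s) (b * s) (c * s) (d * s) = (\<Sum>k\<le>n. qbinom q n k * F k v)"
      if "v \<noteq> 0" for v
    proof -
      have "a * s * (b * s) * (c * s) * (d * s) * q ^ (2 * n + m) = a * b * c * d * q ^ (2 * Suc n + m)"
        by (simp add: q(1) power2_eq_square mult_ac)
      then show ?thesis
        using Suc.IH[OF that, of "a * s" "b * s" "c * s" "d * s"] by (simp only: F_def)
    qed
    have "(w - 1 / w) * aw_poly s (Suc (n + m)) w a b c d =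
        s ^ (n + m) * (aw_weight (1 / w) a b c d * (\<Sum>k\<le>n. qbinom q n k * F k (w / s))
          - aw_weight w a b c d * (\<Sum>k\<le>n. qbinom q n k * F k (s * w)))"
      using s w by (subst aw_raising) (simp_all add: IH)
    also have "\<dots> = (\<Sum>k\<le>n. qbinom q n k *
        (s ^ (n + m) * (aw_weight (1 / w) a b c d * F k (w / s) - aw_weight w a b c d * F k (s * w))))"
      unfolding sum_distrib_left sum_subtractf[symmetric]
      by (intro sum.cong refl) (simp add: algebra_simps)
    also have "\<dots> = (\<Sum>k\<le>n. qbinom q n k * ((q ^ k * w - 1 / w) * E k + (w - q ^ (n - k) / w) * E (Suc k)))"
      unfolding F_def E_def
      by (intro sum.cong refl arg_cong2[where f = "(*)"] aw_poly_add_step s q w) simp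
    also have "\<dots> = (\<Sum>k\<le>n. qbinom q n k * (q ^ k * w - 1 / w) * E k)
        + (\<Sum>k\<le>n. qbinom q n k * (w - q ^ (n - k) / w) * E (Suc k))"
      by (simp add: distrib_left sum.distrib mult.assoc)
    also have "(\<Sum>k\<le>n. qbinom q n k * (q ^ k * w - 1 / w) * E k) =
        (\<Sum>k\<le>Suc n. qbinom q n k * (q ^ k * w - 1 / w) * E k)"
      by (simp add: qbinom_eq_0)
    also have "\<dots> = (w - 1 / w) * E 0 + (\<Sum>k\<le>n. qbinom q n (Suc k) * (q ^ Suc k * w - 1 / w) * E (Suc k))"
      by (subst sum.atMost_Suc_shift) simp
    also have "\<dots> + (\<Sum>k\<le>n. qbinom q n k * (w - q ^ (n - k) / w) * E (Suc k)) =
        (w - 1 / w) * E 0 + (\<Sum>k\<le>n. (w - 1 / w) * (qbinom q (Suc n) (Suc k) * E (Suc k)))"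
    proof -
      have "qbinom q n (Suc k) * (q ^ Suc k * w - 1 / w) * E (Suc k)
          + qbinom q n k * (w - q ^ (n - k) / w) * E (Suc k)
          = (w - 1 / w) * (qbinom q (Suc n) (Suc k) * E (Suc k))" if "k \<le> n" for k
      proof -
        have "x * (u * w - 1 / w) * e + x' * (w - u' / w) * e = (u * x + x') * w * e - (x + u' * x') / w * e"
          for x x' u u' e
          by (simp add: algebra_simps add_divide_distrib)
        from this[of "qbinom q n (Suc k)" "q ^ Suc k" "E (Suc k)" "qbinom q n k" "q ^ (n - k)"]
        show ?thesis
          unfolding qbinom_Suc[OF q(2) that, symmetric] by (simp add: algebra_simps)
      qed
      then show ?thesis
        by (simp add: add.assoc flip: sum.distrib)
    qed
    also have "\<dots> = (w - 1 / w) * (\<Sum>k\<le>Suc n. qbinom q (Suc n) k * E k)"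
      unfolding sum.atMost_Suc_shift[of _ n] by (simp add: distrib_left sum_distrib_left)
    finally show "(w - 1 / w) * aw_poly s (Suc (n + m)) w a b c d = (w - 1 / w) * R w"
      by (simp add: R_def E_def)
  qed
  then show ?case
    by (simp add: R_def)
qed

section \<open>Translation of the coefficients\<close>

text \<open>
  Each factor \<open>1 - q\<^sup>i\<^sup>-\<^sup>n\<close> is \<open>- q\<^sup>i\<^sup>-\<^sup>n (1 - q\<^sup>n\<^sup>-\<^sup>i)\<close>; the signs cancel between the two symbols.
\<close>

lemma qpoch_negative_powers:
  assumes "q \<noteq> 0" "k \<le> n" "k \<le> m"
  shows "qpoch (1 / q ^ n) q k * qpoch (1 / q ^ m) q k * q ^ ((n + m) * k) =
    q ^ (k * (k - 1)) * (qfall q n k * qfall q m k)"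
  using assms(2,3)
proof (induction k)
  case (Suc k)
  have factor: "(1 - 1 / q ^ i * q ^ k) * q ^ i = - (q ^ k * (1 - q ^ (i - k)))" if "Suc k \<le> i" for i
  proof -
    have "q ^ k * q ^ (i - k) = q ^ i"
      using that by (simp flip: power_add)
    then show ?thesis
      using assms(1) by (simp add: algebra_simps)
  qed
  have "Suc k * (Suc k - 1) = k * (k - 1) + (k + k)"
    by (cases k) simp_all
  then have pow: "q ^ (Suc k * (Suc k - 1)) = q ^ (k * (k - 1)) * (q ^ k * q ^ k)"
    by (simp only: power_add)
  have "qpoch (1 / q ^ n) q (Suc k) * qpoch (1 / q ^ m) q (Suc k) * q ^ ((n + m) * Suc k) =
     (qpoch (1 / q ^ n) q k * qpoch (1 / q ^ m) q k * q ^ ((n + m) * k))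
       * (((1 - 1 / q ^ n * q ^ k) * q ^ n) * ((1 - 1 / q ^ m * q ^ k) * q ^ m))"
    by (simp only: qpoch_Suc power_add mult_Suc_right) (simp only: mult_ac)
  also have "\<dots> = q ^ (Suc k * (Suc k - 1)) * (qfall q n (Suc k) * qfall q m (Suc k))"
    unfolding pow factor[OF Suc.prems(1)] factor[OF Suc.prems(2)] qfall_Suc
    using Suc by (simp add: mult_ac)
  finally show ?case .
qed simp

lemma powr_half_nat: "0 < q \<Longrightarrow> q powr (real k / 2) = (q powr (1 / 2)) ^ k"
  by (simp add: powr_powr flip: powr_realpow)

theorem mainTheorem5:
  fixes q a b c d :: real and x z :: complex and n m :: nat
  assumes "0 < q" and "q < 1"
    and "Max {\<bar>a\<bar>, \<bar>b\<bar>, \<bar>c\<bar>, \<bar>d\<bar>} < 1"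
    and "z \<noteq> 0" and "x = (z + inverse z) / 2"
  shows "askey_wilson (n + m) x a b c d q =
    (\<Sum>k=0..min n m.
       qpochs [complex_of_real q powi (- int n), complex_of_real q powi (- int m),
               complex_of_real (a * b * c * d) * complex_of_real q powi (2 * int n + int m - 1)] q k
         / qpoch q q k
       * z powi (- 2 * int k)
       * qpochs [a * z, b * z, c * z, d * z] q k
       * complex_of_real (q powr (- (real k)\<^sup>2 + real k + real n * real m / 2
                                   + real k * real m / 2 + real n * real k))
       * askey_wilson (n - k)
           ((complex_of_real (q powr (real k / 2)) * z
             + complex_of_real (q powr (- (real k / 2))) * inverse z) / 2)
           (a * q powr (real k / 2)) (b * q powr (real k / 2))
           (c * q powr (real k / 2)) (d * q powr (real k / 2)) q
       * askey_wilson (m - k)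
           ((complex_of_real (q powr ((real k - real n) / 2)) * z
             + complex_of_real (q powr ((real n - real k) / 2)) * inverse z) / 2)
           (a * q powr ((real k + real n) / 2)) (b * q powr ((real k + real n) / 2))
           (c * q powr ((real k + real n) / 2)) (d * q powr ((real k + real n) / 2)) q)"
proof -
  define r where "r = q powr (1 / 2)"
  define s where "s = complex_of_real r"
  define Q where "Q = complex_of_real q"
  have r: "r > 0" "r\<^sup>2 = q"
    using assms(1) by (simp_all add: r_def powr_half_sqrt)
  have s: "s \<noteq> 0" and Q: "Q = s\<^sup>2" "norm Q < 1" "Q \<noteq> 0"
    using r assms(1,2) by (auto simp: s_def Q_def simp flip: of_real_power)
  have half: "q powr (real i / 2) = r ^ i" for i
    unfolding r_def by (rule powr_half_nat[OF assms(1)])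
  have norms: "\<bar>a\<bar> < 1" "\<bar>b\<bar> < 1" "\<bar>c\<bar> < 1" "\<bar>d\<bar> < 1"
    using assms(3) by auto
  have "r \<le> 1"
    by (rule power2_le_imp_le) (use r assms(2) in simp_all)
  then have r_le: "r ^ i \<le> 1" for i
    using r(1) by (intro power_le_one) auto
  have shifted: "norm (complex_of_real y * s ^ i) < 1" if "\<bar>y\<bar> < 1" for y i
  proof -
    have "\<bar>y\<bar> * r ^ i \<le> \<bar>y\<bar>"
      using r_le[of i] by (simp add: mult_left_le)
    then show ?thesis
      using that r(1) by (simp add: s_def norm_mult norm_power)
  qed
  have poly: "askey_wilson i ((w + inverse w) / 2) (complex_of_real a * s ^ j) (complex_of_real b * s ^ j)
        (complex_of_real c * s ^ j) (complex_of_real d * s ^ j) Q =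
      aw_poly s i w (complex_of_real a * s ^ j) (complex_of_real b * s ^ j)
        (complex_of_real c * s ^ j) (complex_of_real d * s ^ j)" if "w \<noteq> 0" for i j w
    using norms by (intro askey_wilson_eq_aw_poly s Q that shifted)
  have lhs: "askey_wilson (n + m) x a b c d Q = aw_poly s (n + m) z a b c d"
    unfolding assms(5) using poly[OF assms(4), of "n + m" 0] by simp
  \<comment> \<open>Terms with \<open>m < k \<le> n\<close> vanish, which accounts for the upper limit \<open>min n m\<close>.\<close>
  show ?thesis
    unfolding Q_def[symmetric] lhs aw_poly_add[OF s Q(1,2) assms(4)]
  proof (rule sum.mono_neutral_cong_right)
    show "finite {..n}" "{0..min n m} \<subseteq> {..n}"
      by auto
    show "\<forall>k\<in>{..n} - {0..min n m}. qbinom Q n k * (s ^ (m * (n - k)) * qfall Q m k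
       * qpoch (complex_of_real a * complex_of_real b * complex_of_real c * complex_of_real d * Q ^ (2 * n + m) / Q) Q k
       * aw_factor Q k z a b c d
       * aw_poly s (n - k) (s ^ k * z) (complex_of_real a * s ^ k) (complex_of_real b * s ^ k)
           (complex_of_real c * s ^ k) (complex_of_real d * s ^ k)
       * aw_poly s (m - k) (s ^ k * z / s ^ n) (complex_of_real a * s ^ (k + n)) (complex_of_real b * s ^ (k + n))
           (complex_of_real c * s ^ (k + n)) (complex_of_real d * s ^ (k + n))) = 0"
      by (auto simp: qfall_eq_0)
  next
    fix k assume "k \<in> {0..min n m}"
    then have k: "k \<le> n" "k \<le> m" by auto
    have first: "askey_wilson (n - k)
           ((complex_of_real (q powr (real k / 2)) * z
             + complex_of_real (q powr (- (real k / 2))) * inverse z) / 2)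
           (a * q powr (real k / 2)) (b * q powr (real k / 2))
           (c * q powr (real k / 2)) (d * q powr (real k / 2)) Q =
        aw_poly s (n - k) (s ^ k * z) (complex_of_real a * s ^ k) (complex_of_real b * s ^ k)
           (complex_of_real c * s ^ k) (complex_of_real d * s ^ k)"
      using poly[of "s ^ k * z" "n - k" k] s assms(4)
      by (simp add: powr_minus half s_def power_inverse)
    have shift: "q powr ((real k - real n) / 2) = r ^ k / r ^ n" "q powr ((real n - real k) / 2) = r ^ n / r ^ k"
      "q powr ((real k + real n) / 2) = r ^ (k + n)"
      using half[of "k + n"] by (simp_all add: diff_divide_distrib powr_diff half)
    have arg: "complex_of_real (r ^ k / r ^ n) * z + complex_of_real (r ^ n / r ^ k) * inverse z =
        s ^ k * z / s ^ n + inverse (s ^ k * z / s ^ n)"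
      by (simp add: s_def inverse_eq_divide)
    have param: "complex_of_real (y * r ^ (k + n)) = complex_of_real y * s ^ (k + n)" for y
      by (simp add: s_def)
    have second: "askey_wilson (m - k)
           ((complex_of_real (q powr ((real k - real n) / 2)) * z
             + complex_of_real (q powr ((real n - real k) / 2)) * inverse z) / 2)
           (a * q powr ((real k + real n) / 2)) (b * q powr ((real k + real n) / 2))
           (c * q powr ((real k + real n) / 2)) (d * q powr ((real k + real n) / 2)) Q =
        aw_poly s (m - k) (s ^ k * z / s ^ n) (complex_of_real a * s ^ (k + n)) (complex_of_real b * s ^ (k + n))
           (complex_of_real c * s ^ (k + n)) (complex_of_real d * s ^ (k + n))"
      unfolding shift arg param by (rule poly) (use s assms(4) in simp)
    have exponent: "complex_of_real (q powr (- (real k)\<^sup>2 + real k + real n * real m / 2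
        + real k * real m / 2 + real n * real k)) = s ^ (m * (n - k)) * Q ^ ((n + m) * k) / Q ^ (k * (k - 1))"
    proof -
      have "real (k * (k - 1)) = (real k)\<^sup>2 - real k"
        by (cases k) (simp_all add: power2_eq_square algebra_simps)
      then have "- (real k)\<^sup>2 + real k + real n * real m / 2 + real k * real m / 2 + real n * real k =
          real (m * (n - k)) / 2 + real ((n + m) * k) - real (k * (k - 1))"
        using k by (simp add: of_nat_diff field_simps)
      then have "q powr (- (real k)\<^sup>2 + real k + real n * real m / 2 + real k * real m / 2 + real n * real k) =
          r ^ (m * (n - k)) * q ^ ((n + m) * k) / q ^ (k * (k - 1))"
        using assms(1) by (simp only: powr_add powr_diff half powr_realpow)
      then show ?thesis
        by (simp add: s_def Q_def)
    qed
    have powi: "Q powi (- int n) = 1 / Q ^ n" "Q powi (- int m) = 1 / Q ^ m"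
      "Q powi (2 * int n + int m - 1) = Q ^ (2 * n + m) / Q" "z powi (- 2 * int k) = 1 / z ^ (2 * k)"
    proof -
      have "2 * int n + int m - 1 = int (2 * n + m) - 1" "- 2 * int k = - int (2 * k)"
        by simp_all
      then show "Q powi (2 * int n + int m - 1) = Q ^ (2 * n + m) / Q" "z powi (- 2 * int k) = 1 / z ^ (2 * k)"
        by (simp_all only: power_int_diff[OF disjI1[OF Q(3)]] power_int_minus power_int_of_nat
            power_int_1_right inverse_eq_divide)
    qed (simp_all add: power_int_minus inverse_eq_divide)
    have negative: "qpoch (1 / Q ^ n) Q k * qpoch (1 / Q ^ m) Q k * Q ^ ((n + m) * k) / Q ^ (k * (k - 1)) =
        qfall Q n k * qfall Q m k"
      using qpoch_negative_powers[OF Q(3) k] Q(3) by simp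
    have coefficient: "qpochs [Q powi (- int n), Q powi (- int m), 
         complex_of_real (a * b * c * d) * Q powi (2 * int n + int m - 1)] Q k / qpoch Q Q k
       * z powi (- 2 * int k) * qpochs [a * z, b * z, c * z, d * z] Q k
       * complex_of_real (q powr (- (real k)\<^sup>2 + real k + real n * real m / 2
                                   + real k * real m / 2 + real n * real k)) =
       qbinom Q n k * (s ^ (m * (n - k)) * qfall Q m k
       * qpoch (complex_of_real a * complex_of_real b * complex_of_real c * complex_of_real d * Q ^ (2 * n + m) / Q) Q k
       * aw_factor Q k z a b c d)"
    proof -
      have rearrange: "A * B * U / R * (1 / Z) * (W * X * Y * V) * (S * I / J) =
          N / R * (S * M * U * (W * X * Y * V / Z))" if "A * B * I / J = N * M"
        for A B U R Z W X Y V S I J N M :: complex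
      proof -
        have "A * B * U / R * (1 / Z) * (W * X * Y * V) * (S * I / J) =
            (A * B * I / J) * (S * U / R * (W * X * Y * V / Z))"
          by (simp add: mult_ac)
        then show ?thesis
          unfolding that by (simp add: mult_ac)
      qed
      have "qpochs [u, v, w] Q k = qpoch u Q k * qpoch v Q k * qpoch w Q k"
        "qpochs [u, v, w, y] Q k = qpoch u Q k * qpoch v Q k * qpoch w Q k * qpoch y Q k" for u v w y
        by (simp_all add: qpochs_def mult.assoc)
      then show ?thesis
        unfolding powi exponent aw_factor_def qbinom_def of_real_mult times_divide_eq_right[of _ "Q ^ _" Q]
        by (simp only: rearrange[OF negative])
    qed
    show "qbinom Q n k * (s ^ (m * (n - k)) * qfall Q m k
       * qpoch (complex_of_real a * complex_of_real b * complex_of_real c * complex_of_real d * Q ^ (2 * n + m) / Q) Q k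
       * aw_factor Q k z a b c d
       * aw_poly s (n - k) (s ^ k * z) (complex_of_real a * s ^ k) (complex_of_real b * s ^ k)
           (complex_of_real c * s ^ k) (complex_of_real d * s ^ k)
       * aw_poly s (m - k) (s ^ k * z / s ^ n) (complex_of_real a * s ^ (k + n)) (complex_of_real b * s ^ (k + n))
           (complex_of_real c * s ^ (k + n)) (complex_of_real d * s ^ (k + n))) =
       qpochs [Q powi (- int n), Q powi (- int m),
               complex_of_real (a * b * c * d) * Q powi (2 * int n + int m - 1)] Q k
         / qpoch Q Q k
       * z powi (- 2 * int k)
       * qpochs [a * z, b * z, c * z, d * z] Q k
       * complex_of_real (q powr (- (real k)\<^sup>2 + real k + real n * real m / 2
                                   + real k * real m / 2 + real n * real k))
       * askey_wilson (n - k)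
           ((complex_of_real (q powr (real k / 2)) * z
             + complex_of_real (q powr (- (real k / 2))) * inverse z) / 2)
           (a * q powr (real k / 2)) (b * q powr (real k / 2))
           (c * q powr (real k / 2)) (d * q powr (real k / 2)) Q
       * askey_wilson (m - k)
           ((complex_of_real (q powr ((real k - real n) / 2)) * z
             + complex_of_real (q powr ((real n - real k) / 2)) * inverse z) / 2)
           (a * q powr ((real k + real n) / 2)) (b * q powr ((real k + real n) / 2))
           (c * q powr ((real k + real n) / 2)) (d * q powr ((real k + real n) / 2)) Q"
      unfolding coefficient first second by (simp only: mult.assoc)
  qed
qed

end
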